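(* Let $\mathbb{T}$ be a time scale, let $A:\mathbb{T}\to\mathbb{R}^{n\times n}$ be regressive, and let $L$ be a Lyapunov transformation, with change of variables $z(t)=L^{-1}(t)x(t)$. Then the system $$x^\Delta(t)=A(t)x(t),\quad x(t_0)=x_0$$ is uniformly exponentially stable if and only if the system $$z^\Delta(t)=\left[(L^\sigma(t))^{-1}A(t)L(t)-(L^\sigma(t))^{-1}L^\Delta(t)\right]z(t),\quad z(t_0)=z_0$$ is uniformly exponentially stable.
   Context: A time scale $\mathbb{T}$ is a nonempty closed subset of $\mathbb{R}$; $\sigma(t)=\inf\{s\in\mathbb{T}:s>t\}$, $\mu(t)=\sigma(t)-t$, $L^\sigma(t)=L(\sigma(t))$, and $f^\Delta$ is the delta (Hilger) derivative. $f$ is rd-continuous if continuous at right-dense points with finite left-sided limits at left-dense points; $C^1_{\mathrm{rd}}$ is the set of delta differentiable functions with rd-continuous derivative. $A$ is regressive if it is rd-continuous and $I+\mu(t)A(t)$ is invertible for all $t$. A Lyapunov transformation is an invertible matrix $L(t)\in C^1_{\mathrm{rd}}(\mathbb{T},\mathbb{R}^{n\times n})$ such that, for some positive $\eta,\rho\in\mathbb{R}$, $\|L(t)\|\le\rho$ and $\det L(t)\ge\eta$ for all $t\in\mathbb{T}$. $\mathcal{R}^+$ is the set of rd-continuous $f:\mathbb{T}\to\mathbb{R}$ with $1+\mu(t)f(t)>0$ for all $t$. A linear system is uniformly exponentially stable if there are finite positive constants $\gamma,\lambda$ with $-\lambda\in\mathcal{R}^+$ such that for any $t_0\in\mathbb{T}$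 and any initial value $x(t_0)$ the corresponding solution satisfies $\|x(t)\|\le\|x(t_0)\|\gamma e_{-\lambda}(t,t_0)$ for all $t\in\mathbb{T}$, $t\ge t_0$, where $e_{-\lambda}(\cdot,t_0)$ is the solution of $y^\Delta=-\lambda y$, $y(t_0)=1$. *)

theory Defs
  imports "HOL-Analysis.Analysis"
begin

definition time_scale :: "real set \<Rightarrow> bool" where
  "time_scale T \<longleftrightarrow> closed T \<and> T \<noteq> {}"

text \<open>The usual conventions \<open>inf {} = sup T\<close> and \<open>sup {} = inf T\<close> are in force, so that the
  maximum (minimum) of a time scale, if any, is a fixed point of the forward (backward) jump.\<close>

definition forward_jump :: "real set \<Rightarrow> real \<Rightarrow> real" where
  "forward_jump T t = (if {s \<in> T. s > t} = {} then Sup T else Inf {s \<in> T. s > t})"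

definition backward_jump :: "real set \<Rightarrow> real \<Rightarrow> real" where
  "backward_jump T t = (if {s \<in> T. s < t} = {} then Inf T else Sup {s \<in> T. s < t})"

definition graininess :: "real set \<Rightarrow> real \<Rightarrow> real" where
  "graininess T t = forward_jump T t - t"

text \<open>The set on which delta derivatives are considered: \<open>T\<close> without its maximum, if that
  maximum exists and is left-scattered (there, every value would qualify as a derivative).\<close>

definition kappa :: "real set \<Rightarrow> real set" where
  "kappa T = {t \<in> T. \<not> ((\<forall>s\<in>T. s \<le> t) \<and> backward_jump T t < t)}"

definition has_delta_derivative ::
  "real set \<Rightarrow> (real \<Rightarrow> 'a::real_normed_vector) \<Rightarrow> 'a \<Rightarrow> real \<Rightarrow> bool" where
  "has_delta_derivative T f D t \<longleftrightarrow>
     (\<forall>\<epsilon>>0. \<exists>\<delta>>0. \<forall>s\<in>T. \<bar>s - t\<bar> < \<delta> \<longrightarrow>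
        norm (f (forward_jump T t) - f s - (forward_jump T t - s) *\<^sub>R D)
          \<le> \<epsilon> * \<bar>forward_jump T t - s\<bar>)"

definition delta_deriv :: "real set \<Rightarrow> (real \<Rightarrow> 'a::real_normed_vector) \<Rightarrow> real \<Rightarrow> 'a" where
  "delta_deriv T f t = (THE D. has_delta_derivative T f D t)"

text \<open>Rd-continuity of \<open>f\<close> on \<open>S\<close>, which is \<open>T\<close> or \<open>kappa T\<close>; right- and left-density always
  refer to \<open>T\<close>. The maximum of \<open>T\<close> counts as right-dense, so \<open>f\<close> has to be continuous there.\<close>

definition rd_continuous_on ::
  "real set \<Rightarrow> real set \<Rightarrow> (real \<Rightarrow> 'a::real_normed_vector) \<Rightarrow> bool" where
  "rd_continuous_on T S f \<longleftrightarrow>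
     (\<forall>t\<in>S. (forward_jump T t = t \<longrightarrow> continuous (at t within S) f) \<and>
            (backward_jump T t = t \<longrightarrow> (\<exists>l. (f \<longlongrightarrow> l) (at t within (S \<inter> {..<t})))))"

definition C1_rd :: "real set \<Rightarrow> (real \<Rightarrow> 'a::real_normed_vector) \<Rightarrow> bool" where
  "C1_rd T f \<longleftrightarrow>
     (\<forall>t\<in>kappa T. \<exists>D. has_delta_derivative T f D t) \<and>
     rd_continuous_on T (kappa T) (delta_deriv T f)"

definition regressive :: "real set \<Rightarrow> (real \<Rightarrow> real^'n^'n) \<Rightarrow> bool" where
  "regressive T A \<longleftrightarrow>
     rd_continuous_on T T A \<and> (\<forall>t\<in>T. invertible (mat 1 + graininess T t *\<^sub>R A t))"

definition positively_regressive :: "real set \<Rightarrow> (real \<Rightarrow> real) \<Rightarrow> bool" where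
  "positively_regressive T p \<longleftrightarrow>
     rd_continuous_on T T p \<and> (\<forall>t\<in>T. 1 + graininess T t * p t > 0)"

text \<open>The matrix norm is the one induced by the Euclidean norm; \<open>norm\<close> on the matrix type would
  be the Frobenius norm.\<close>

definition lyapunov_transformation :: "real set \<Rightarrow> (real \<Rightarrow> real^'n^'n) \<Rightarrow> bool" where
  "lyapunov_transformation T L \<longleftrightarrow>
     C1_rd T L \<and> (\<forall>t\<in>T. invertible (L t)) \<and>
     (\<exists>\<eta>>0. \<exists>\<rho>>0. \<forall>t\<in>T. onorm ((*v) (L t)) \<le> \<rho> \<and> det (L t) \<ge> \<eta>)"

definition solves_delta_ivp ::
  "real set \<Rightarrow> (real \<Rightarrow> 'a \<Rightarrow> 'a) \<Rightarrow> real \<Rightarrow> 'a \<Rightarrow> (real \<Rightarrow> 'a::real_normed_vector) \<Rightarrow> bool" where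
  "solves_delta_ivp T F t\<^sub>0 x\<^sub>0 x \<longleftrightarrow>
     (\<forall>t\<in>kappa T. has_delta_derivative T x (F t (x t)) t) \<and> x t\<^sub>0 = x\<^sub>0"

text \<open>A solution is determined on \<open>T\<close> only, so the description is of its value at \<open>t\<close> and not of
  the function.\<close>

definition ts_exp :: "real set \<Rightarrow> (real \<Rightarrow> real) \<Rightarrow> real \<Rightarrow> real \<Rightarrow> real" where
  "ts_exp T p t t\<^sub>0 = (THE v. \<exists>y. solves_delta_ivp T (\<lambda>s u. p s * u) t\<^sub>0 1 y \<and> y t = v)"

definition uniformly_exponentially_stable :: "real set \<Rightarrow> (real \<Rightarrow> real^'n^'n) \<Rightarrow> bool" where
  "uniformly_exponentially_stable T A \<longleftrightarrow>
     (\<exists>\<gamma>>0. \<exists>\<alpha>>0. positively_regressive T (\<lambda>_. - \<alpha>) \<and>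
        (\<forall>t\<^sub>0\<in>T. \<forall>x\<^sub>0 x. solves_delta_ivp T (\<lambda>s u. A s *v u) t\<^sub>0 x\<^sub>0 x \<longrightarrow>
           (\<forall>t\<in>T. t \<ge> t\<^sub>0 \<longrightarrow> norm (x t) \<le> norm x\<^sub>0 * \<gamma> * ts_exp T (\<lambda>_. - \<alpha>) t t\<^sub>0)))"

end

theory Submission
  imports Defs
begin

text \<open>The substitution \<open>x = L z\<close> is a bijection between the solutions of the two systems: the delta
  derivative is a limit of difference quotients through \<open>\<sigma>(t)\<close>, for which the product rule
  \<open>(L z)\<^sup>\<Delta> = L\<^sup>\<sigma> z\<^sup>\<Delta> + L\<^sup>\<Delta> z\<close> and its solution for \<open>z\<^sup>\<Delta>\<close> are algebraic identities. By compactness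
  of \<open>{M. \<parallel>M\<parallel> \<le> \<rho>, det M \<ge> \<eta>}\<close> a Lyapunov transformation distorts norms by bounded factors, so the
  exponential estimate passes from one system to the other with the same rate. Nothing about
  \<open>e\<^bsub>-\<lambda>\<^esub>\<close> is needed: it is nonnegative wherever the estimate holds for a nonzero initial value.\<close>

section \<open>Delta derivatives as limits along a filter\<close>

text \<open>\<open>forward_jump T t\<close> is removed because the difference quotient through it
  divides by zero there. At a right-scattered \<open>t\<close> the point \<open>t\<close> itself
  remains.\<close>

definition delta_filter :: "real set \<Rightarrow> real \<Rightarrow> real filter" where
  "delta_filter T t = inf (nhds t) (principal (T - {forward_jump T t}))"

lemma eventually_delta_filter:
  "eventually P (delta_filter T t) \<longleftrightarrow>
     (\<exists>\<delta>>0. \<forall>s\<in>T. \<bar>s - t\<bar> < \<delta> \<longrightarrow> s \<noteq> forward_jump T t \<longrightarrow> P s)"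
  unfolding delta_filter_def eventually_inf_principal eventually_nhds_metric
  by (auto simp: dist_real_def)

lemma eventually_delta_filter_mem:
  "eventually (\<lambda>s. s \<in> T \<and> s \<noteq> forward_jump T t) (delta_filter T t)"
  by (auto simp: eventually_delta_filter intro: exI[of _ 1])

lemma tendsto_ident_delta_filter: "((\<lambda>s. s) \<longlongrightarrow> t) (delta_filter T t)"
  unfolding delta_filter_def by (auto simp: filterlim_def)

text \<open>Dividing the defining inequality by \<bar>\<sigma>(t) - s\<bar> bounds the distance of
  the quotient from \<open>D\<close>; at s = \<sigma>(t) it reads 0 \<le> 0. This opens delta
  derivatives to the limit rules for sums and products.\<close>

lemma has_delta_derivative_iff_tendsto:
  "has_delta_derivative T f D t \<longleftrightarrow>
     ((\<lambda>s. (f (forward_jump T t) - f s) /\<^sub>R (forward_jump T t - s)) \<longlongrightarrow> D) (delta_filter T t)"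
  (is "_ \<longleftrightarrow> (?Q \<longlongrightarrow> D) _")
proof -
  let ?\<sigma> = "forward_jump T t"
  have quot: "norm (f ?\<sigma> - f s - (?\<sigma> - s) *\<^sub>R D) = \<bar>?\<sigma> - s\<bar> * dist (?Q s) D"
    if "s \<noteq> ?\<sigma>" for s
  proof -
    have "f ?\<sigma> - f s - (?\<sigma> - s) *\<^sub>R D = (?\<sigma> - s) *\<^sub>R (?Q s - D)"
      using that by (simp add: scaleR_diff_right)
    then show ?thesis by (simp only: norm_scaleR dist_norm real_norm_def)
  qed
  have le: "norm (f ?\<sigma> - f s - (?\<sigma> - s) *\<^sub>R D) \<le> \<epsilon> * \<bar>?\<sigma> - s\<bar> \<longleftrightarrow>
      (s \<noteq> ?\<sigma> \<longrightarrow> dist (?Q s) D \<le> \<epsilon>)" for s \<epsilon>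
    by (cases "s = ?\<sigma>") (simp_all add: quot mult.commute[of \<epsilon>])
  have "has_delta_derivative T f D t \<longleftrightarrow>
      (\<forall>\<epsilon>>0. eventually (\<lambda>s. dist (?Q s) D \<le> \<epsilon>) (delta_filter T t))"
    unfolding has_delta_derivative_def eventually_delta_filter le ..
  also have "\<dots> \<longleftrightarrow> (?Q \<longlongrightarrow> D) (delta_filter T t)"
    unfolding tendsto_iff
  proof (intro iffI allI impI)
    fix \<epsilon> :: real
    assume "\<forall>\<epsilon>>0. eventually (\<lambda>s. dist (?Q s) D \<le> \<epsilon>) (delta_filter T t)" and "0 < \<epsilon>"
    then have "eventually (\<lambda>s. dist (?Q s) D \<le> \<epsilon> / 2) (delta_filter T t)"
      using half_gt_zero by blast
    then show "eventually (\<lambda>s. dist (?Q s) D < \<epsilon>) (delta_filter T t)"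
      by (rule eventually_mono) (use \<open>0 < \<epsilon>\<close> in linarith)
  qed (auto elim!: eventually_mono)
  finally show ?thesis .
qed

text \<open>If \<open>delta_filter T t\<close> is trivial, which happens only at isolated points fixed by the forward
  jump, then every value is a derivative, so the unspecified value of \<^const>\<open>The\<close> does no harm.\<close>

lemma has_delta_derivative_delta_deriv:
  assumes "has_delta_derivative T f D t"
  shows "has_delta_derivative T f (delta_deriv T f t) t"
proof (cases "delta_filter T t = bot")
  case True
  then show ?thesis by (simp add: has_delta_derivative_iff_tendsto)
next
  case False
  have "delta_deriv T f t = D"
    unfolding delta_deriv_def using assms False
    by (intro the_equality) (auto simp: has_delta_derivative_iff_tendsto intro: tendsto_unique)
  with assms show ?thesis by simp
qed

text \<open>Since f(s) equals f(\<sigma>(t)) minus (\<sigma>(t) - s) times the quotient, it has a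
  limit; it remains to identify that limit.\<close>

lemma has_delta_derivative_imp_tendsto:
  assumes "has_delta_derivative T f D t" and "t \<in> T"
  shows "(f \<longlongrightarrow> f t) (delta_filter T t)"
proof -
  let ?\<sigma> = "forward_jump T t" and ?F = "delta_filter T t"
  let ?Q = "\<lambda>s. (f ?\<sigma> - f s) /\<^sub>R (?\<sigma> - s)"
  have Q: "(?Q \<longlongrightarrow> D) ?F" using assms(1) by (simp add: has_delta_derivative_iff_tendsto)
  have "((\<lambda>s. f ?\<sigma> - (?\<sigma> - s) *\<^sub>R ?Q s) \<longlongrightarrow> f ?\<sigma> - (?\<sigma> - t) *\<^sub>R D) ?F"
    by (intro tendsto_intros tendsto_ident_delta_filter Q)
  moreover have "eventually (\<lambda>s. f ?\<sigma> - (?\<sigma> - s) *\<^sub>R ?Q s = f s) ?F"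
    using eventually_delta_filter_mem by (rule eventually_mono) auto
  ultimately have lim: "(f \<longlongrightarrow> f ?\<sigma> - (?\<sigma> - t) *\<^sub>R D) ?F"
    by (rule Lim_transform_eventually)
  show ?thesis
  proof (cases "?\<sigma> = t")
    case True
    with lim show ?thesis by simp
  next
    case False
    \<comment> \<open>Here every set of the filter contains \<open>t\<close>, so a limit along it
      must agree with the value at \<open>t\<close>.\<close>
    have "principal {t} \<le> ?F"
      unfolding le_filter_def eventually_principal eventually_delta_filter
      using assms(2) False by auto
    with lim have "(f \<longlongrightarrow> f ?\<sigma> - (?\<sigma> - t) *\<^sub>R D) (principal {t})"
      by (rule tendsto_mono[rotated])
    then have "f ?\<sigma> - (?\<sigma> - t) *\<^sub>R D = f t"
      by (rule tendsto_unique[rotated]) (auto simp: tendsto_principal_singleton principal_eq_bot_iff)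
    with lim show ?thesis by simp
  qed
qed

text \<open>The transformed system inverts \<open>L\<close> at \<sigma>(t), and invertibility is
  known only on \<open>T\<close>. Closedness of \<open>T\<close> keeps the infimum inside.\<close>

lemma forward_jump_mem:
  assumes "time_scale T" and "t \<in> T"
  shows "forward_jump T t \<in> T"
proof (cases "{s \<in> T. s > t} = {}")
  case True
  then have "Sup T = t" using assms(2) by (intro cSup_eq_maximum) force+
  with True assms(2) show ?thesis by (simp add: forward_jump_def)
next
  case False
  have "bdd_below {s \<in> T. s > t}" by (rule bdd_belowI[of _ t]) auto
  with False have "Inf {s \<in> T. s > t} \<in> closure {s \<in> T. s > t}" by (rule closure_contains_Inf)
  also have "\<dots> \<subseteq> T"
    using assms(1) by (intro closure_minimal) (auto simp: time_scale_def)
  finally show ?thesis using False by (auto simp: forward_jump_def)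
qed

section \<open>The product rule and its solution for the second factor\<close>

lemma bounded_bilinear_matrix_vector_mult:
  "bounded_bilinear ((*v) :: real^'n^'m \<Rightarrow> real^'n \<Rightarrow> real^'m)"
  unfolding bilinear_conv_bounded_bilinear[symmetric] bilinear_def
  by (auto intro!: linearI simp: matrix_vector_mult_add_rdistrib matrix_vector_right_distrib
      scaleR_matrix_vector_assoc matrix_vector_mult_scaleR)

lemmas tendsto_matrix_vector_mult =
  bounded_bilinear.tendsto[OF bounded_bilinear_matrix_vector_mult]

lemma matrix_inv_mult_vector:
  fixes M :: "real^'n^'n"
  assumes "invertible M"
  shows "matrix_inv M *v (M *v u) = u" and "M *v (matrix_inv M *v u) = u"
proof -
  have "M ** matrix_inv M = mat 1 \<and> matrix_inv M ** M = mat 1"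
    using assms unfolding invertible_def matrix_inv_def by (rule someI_ex)
  then show "matrix_inv M *v (M *v u) = u" and "M *v (matrix_inv M *v u) = u"
    by (simp_all add: matrix_vector_mul_assoc)
qed

text \<open>With \<open>u = z(s)\<close> this is the increment of \<open>L z\<close> between \<open>s\<close> and \<open>\<sigma>(t)\<close>.\<close>

lemma matrix_vector_diff_quotient:
  fixes M N :: "real^'n^'n"
  shows "(M *v w - N *v u) /\<^sub>R c = M *v ((w - u) /\<^sub>R c) + ((M - N) /\<^sub>R c) *v u"
  by (simp add: matrix_vector_mult_scaleR scaleR_matrix_vector_assoc[symmetric]
      matrix_vector_mult_diff_distrib matrix_vector_mult_diff_rdistrib algebra_simps)

text \<open>The limit of the preceding identity: its first matrix is fixed at \<sigma>(t), so only
  z(s) varies outside the two quotients, and it tends to z(t).\<close>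

lemma has_delta_derivative_matrix_vector_mult:
  fixes L :: "real \<Rightarrow> real^'n^'n"
  assumes "has_delta_derivative T L L' t" and "has_delta_derivative T z z' t" and "t \<in> T"
  shows "has_delta_derivative T (\<lambda>s. L s *v z s) (L (forward_jump T t) *v z' + L' *v z t) t"
  unfolding has_delta_derivative_iff_tendsto matrix_vector_diff_quotient
  using assms has_delta_derivative_imp_tendsto[OF assms(2,3)]
  by (intro tendsto_add tendsto_matrix_vector_mult tendsto_const)
    (simp_all add: has_delta_derivative_iff_tendsto)

text \<open>Solving the product rule for the derivative of the second factor requires only that this factor
  is continuous at \<open>t\<close>; the lower bound on \<open>L\<close> provides that without differentiating \<open>L\<^sup>-\<^sup>1\<close>.\<close>

lemma has_delta_derivative_matrix_inv_mult:
  fixes L :: "real \<Rightarrow> real^'n^'n"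
  assumes "has_delta_derivative T L L' t" and "has_delta_derivative T x x' t"
    and T: "time_scale T" "t \<in> T"
    and inv: "\<And>s. s \<in> T \<Longrightarrow> invertible (L s)"
    and "m > 0" and lower: "\<And>s u. s \<in> T \<Longrightarrow> m * norm u \<le> norm (L s *v u)"
  shows "has_delta_derivative T (\<lambda>s. matrix_inv (L s) *v x s)
    (matrix_inv (L (forward_jump T t)) *v (x' - L' *v (matrix_inv (L t) *v x t))) t"
proof -
  let ?\<sigma> = "forward_jump T t" and ?F = "delta_filter T t"
  define z where "z s = matrix_inv (L s) *v x s" for s
  have Lz: "L s *v z s = x s" if "s \<in> T" for s
    by (simp add: z_def matrix_inv_mult_vector inv that)
  have \<sigma>: "?\<sigma> \<in> T" using T by (rule forward_jump_mem)
  \<comment> \<open>L(s) maps z(s) - z(t) to x(s) - L(s) z(t), which tends to x(t) - L(t) z(t) = 0.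
    The lower bound on \<open>L\<close> carries this back to z(s) - z(t).\<close>
  have "((\<lambda>s. norm (x s - L s *v z t) / m) \<longlongrightarrow> norm (x t - L t *v z t) / m) ?F"
    using assms(1-4,6)
    by (intro tendsto_intros tendsto_matrix_vector_mult has_delta_derivative_imp_tendsto) auto
  then have "((\<lambda>s. norm (x s - L s *v z t) / m) \<longlongrightarrow> 0) ?F" by (simp add: Lz T)
  moreover have "eventually (\<lambda>s. norm (z s - z t) \<le> norm (x s - L s *v z t) / m) ?F"
    using eventually_delta_filter_mem
  proof (rule eventually_mono)
    fix s assume s: "s \<in> T \<and> s \<noteq> ?\<sigma>"
    then show "norm (z s - z t) \<le> norm (x s - L s *v z t) / m"
      using lower[of s "z s - z t"] \<open>m > 0\<close>
      by (simp add: matrix_vector_mult_diff_distrib Lz pos_le_divide_eq mult.commute)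
  qed
  ultimately have "((\<lambda>s. z s - z t) \<longlongrightarrow> 0) ?F" by (rule Lim_null_comparison[rotated])
  then have z: "(z \<longlongrightarrow> z t) ?F" by (simp add: LIM_zero_iff)
  \<comment> \<open>The quotient of \<open>x\<close> minus the term from the quotient of
    \<open>L\<close>: what remains is L(\<sigma>(t)) applied to the quotient of
    \<open>z\<close>.\<close>
  let ?Q = "\<lambda>s. (x ?\<sigma> - x s) /\<^sub>R (?\<sigma> - s) - ((L ?\<sigma> - L s) /\<^sub>R (?\<sigma> - s)) *v z s"
  have "((\<lambda>s. matrix_inv (L ?\<sigma>) *v ?Q s) \<longlongrightarrow> matrix_inv (L ?\<sigma>) *v (x' - L' *v z t)) ?F"
    using assms(1,2) z
    by (intro tendsto_diff tendsto_matrix_vector_mult tendsto_const)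
      (simp_all add: has_delta_derivative_iff_tendsto)
  moreover have "eventually (\<lambda>s. matrix_inv (L ?\<sigma>) *v ?Q s = (z ?\<sigma> - z s) /\<^sub>R (?\<sigma> - s)) ?F"
    using eventually_delta_filter_mem
  proof (rule eventually_mono)
    fix s assume s: "s \<in> T \<and> s \<noteq> ?\<sigma>"
    have "?Q s = L ?\<sigma> *v ((z ?\<sigma> - z s) /\<^sub>R (?\<sigma> - s))"
      using matrix_vector_diff_quotient[of "?\<sigma> - s" "L ?\<sigma>" "z ?\<sigma>" "L s" "z s"] s \<sigma>
      by (simp add: Lz)
    then show "matrix_inv (L ?\<sigma>) *v ?Q s = (z ?\<sigma> - z s) /\<^sub>R (?\<sigma> - s)"
      using matrix_inv_mult_vector(1)[OF inv[OF \<sigma>]] by metis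
  qed
  ultimately have "((\<lambda>s. (z ?\<sigma> - z s) /\<^sub>R (?\<sigma> - s)) \<longlongrightarrow> matrix_inv (L ?\<sigma>) *v (x' - L' *v z t)) ?F"
    by (rule Lim_transform_eventually)
  then show ?thesis by (simp add: has_delta_derivative_iff_tendsto z_def)
qed

section \<open>A lower bound uniform over all admissible matrices\<close>

text \<open>On a compact set of matrices times the unit sphere, \<open>norm (M *v u)\<close> attains
  its minimum, which is positive because the determinant does not vanish.\<close>

lemma det_ge_imp_lower_bound:
  assumes "\<eta> > 0"
  obtains m where "m > 0"
    "\<And>(M :: real^'n^'n) u. onorm ((*v) M) \<le> \<rho> \<Longrightarrow> det M \<ge> \<eta> \<Longrightarrow> m * norm u \<le> norm (M *v u)"
proof -
  \<comment> \<open>Bounding entries instead of the operator norm gives a larger set whose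
    closedness and boundedness are read off coordinatewise.\<close>
  define K where "K = {M :: real^'n^'n. (\<forall>i j. \<bar>M $ i $ j\<bar> \<le> \<rho>) \<and> det M \<ge> \<eta>}"
  have "closed K"
    unfolding K_def det_def
    by (intro closed_Collect_conj closed_Collect_all closed_Collect_le continuous_intros)
  moreover have "bounded K"
  proof (rule boundedI)
    fix M assume "M \<in> K"
    then have "norm (M $ i) \<le> (\<Sum>j::'n\<in>UNIV. \<rho>)" for i
      by (intro order_trans[OF norm_le_l1_cart] sum_mono) (auto simp: K_def)
    then have "(\<Sum>i\<in>UNIV. norm (M $ i)) \<le> (\<Sum>i::'n\<in>UNIV. \<Sum>j::'n\<in>UNIV. \<rho>)"
      by (intro sum_mono)
    moreover have "norm M \<le> (\<Sum>i\<in>UNIV. norm (M $ i))"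
      unfolding norm_vec_def by (rule L2_set_le_sum) simp
    ultimately show "norm M \<le> (\<Sum>i::'n\<in>UNIV. \<Sum>j::'n\<in>UNIV. \<rho>)" by linarith
  qed
  ultimately have "compact K" by (simp add: compact_eq_bounded_closed)
  then have C: "compact (K \<times> sphere (0::real^'n) 1)" by (intro compact_Times) auto
  have cont: "continuous_on (K \<times> sphere (0::real^'n) 1) (\<lambda>(M, u). norm (M *v u))"
    unfolding split_def
    by (intro continuous_on_norm
        bounded_bilinear.continuous_on[OF bounded_bilinear_matrix_vector_mult] continuous_intros)
  have pos: "0 < norm (M *v u)" if "M \<in> K" "norm u = 1" for M u
  proof -
    have "invertible M" using that(1) \<open>\<eta> > 0\<close> by (auto simp: K_def invertible_det_nz)
    then show ?thesis
      using that(2) matrix_inv_mult_vector(1)[of M u] by auto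
  qed
  obtain m where m: "m > 0" "\<And>M u. M \<in> K \<Longrightarrow> norm u = 1 \<Longrightarrow> m \<le> norm (M *v u)"
  proof (cases "K = {}")
    case True
    then show ?thesis using that[of 1] by auto
  next
    case False
    then have "K \<times> sphere (0::real^'n) 1 \<noteq> {}" by simp
    from continuous_attains_inf[OF C this cont] obtain M u where
      "M \<in> K" "norm u = 1" and
      "\<And>N v. N \<in> K \<Longrightarrow> norm v = 1 \<Longrightarrow> norm (M *v u) \<le> norm (N *v v)"
      by fastforce
    then show ?thesis using that[of "norm (M *v u)"] pos by blast
  qed
  show ?thesis
  proof (rule that[OF m(1)])
    fix M :: "real^'n^'n" and u
    assume M: "onorm ((*v) M) \<le> \<rho>" "det M \<ge> \<eta>"
    then have "M \<in> K"
      unfolding K_def using matrix_component_le_onorm[of M] by (auto intro: order_trans)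
    then show "m * norm u \<le> norm (M *v u)"
      using m(2)[of M "u /\<^sub>R norm u"]
      by (cases "u = 0") (auto simp: matrix_vector_mult_scaleR field_simps)
  qed
qed

section \<open>Transfer of stability between the two systems\<close>

text \<open>Serves both directions of the equivalence: the rate \<alpha> is kept, and \<gamma> picks
  up one factor for each norm comparison, at \<open>t\<close> and at the initial time.\<close>

lemma uniformly_exponentially_stable_transfer:
  fixes A B :: "real \<Rightarrow> real^'n^'n"
  assumes stable: "uniformly_exponentially_stable T A" and "c > 0" "d > 0"
    and sol: "\<And>t\<^sub>0 y\<^sub>0 y. t\<^sub>0 \<in> T \<Longrightarrow> solves_delta_ivp T (\<lambda>s u. B s *v u) t\<^sub>0 y\<^sub>0 y \<Longrightarrow>
      \<exists>x. solves_delta_ivp T (\<lambda>s u. A s *v u) t\<^sub>0 (x t\<^sub>0) x \<and>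
        (\<forall>t\<in>T. norm (y t) \<le> c * norm (x t) \<and> norm (x t) \<le> d * norm (y t))"
  shows "uniformly_exponentially_stable T B"
proof -
  obtain \<gamma> \<alpha> where "\<gamma> > 0" "\<alpha> > 0" and pr: "positively_regressive T (\<lambda>_. - \<alpha>)"
    and est: "\<And>t\<^sub>0 x\<^sub>0 x t. t\<^sub>0 \<in> T \<Longrightarrow> solves_delta_ivp T (\<lambda>s u. A s *v u) t\<^sub>0 x\<^sub>0 x \<Longrightarrow> t \<in> T \<Longrightarrow>
      t \<ge> t\<^sub>0 \<Longrightarrow> norm (x t) \<le> norm x\<^sub>0 * \<gamma> * ts_exp T (\<lambda>_. - \<alpha>) t t\<^sub>0"
    using stable unfolding uniformly_exponentially_stable_def by metis
  have "norm (y t) \<le> norm y\<^sub>0 * (c * d * \<gamma>) * ts_exp T (\<lambda>_. - \<alpha>) t t\<^sub>0"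
    if t: "t\<^sub>0 \<in> T" "t \<in> T" "t \<ge> t\<^sub>0" and y: "solves_delta_ivp T (\<lambda>s u. B s *v u) t\<^sub>0 y\<^sub>0 y"
    for t\<^sub>0 y\<^sub>0 y t
  proof -
    let ?e = "ts_exp T (\<lambda>_. - \<alpha>) t t\<^sub>0"
    obtain x where x: "solves_delta_ivp T (\<lambda>s u. A s *v u) t\<^sub>0 (x t\<^sub>0) x"
      and xy: "\<And>t. t \<in> T \<Longrightarrow> norm (y t) \<le> c * norm (x t)"
        "\<And>t. t \<in> T \<Longrightarrow> norm (x t) \<le> d * norm (y t)"
      using sol[OF t(1) y] by blast
    have y0: "y t\<^sub>0 = y\<^sub>0" using y by (simp add: solves_delta_ivp_def)
    have bound: "norm (x t) \<le> norm (x t\<^sub>0) * \<gamma> * ?e" using est[OF t(1) x t(2,3)] .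
    \<comment> \<open>Enlarging the initial norm requires \<open>?e\<close> to be nonnegative, which
      \<open>bound\<close> forces unless the initial value of \<open>x\<close> is 0. In that case
      \<open>y\<close> starts at 0 too and both sides vanish.\<close>
    have "norm (x t\<^sub>0) * \<gamma> * ?e \<le> (d * norm y\<^sub>0) * \<gamma> * ?e"
    proof (cases "x t\<^sub>0 = 0")
      case True
      then show ?thesis using xy(1)[OF t(1)] y0 by simp
    next
      case False
      have "0 \<le> (norm (x t\<^sub>0) * \<gamma>) * ?e" using bound norm_ge_zero[of "x t"] by linarith
      moreover have "0 < norm (x t\<^sub>0) * \<gamma>" using False \<open>\<gamma> > 0\<close> by simp
      ultimately have "0 \<le> ?e" by (simp only: zero_le_mult_iff) linarith
      then show ?thesis
        using xy(2)[OF t(1)] y0 \<open>\<gamma> > 0\<close> by (intro mult_right_mono) auto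
    qed
    with bound have "norm (x t) \<le> (d * norm y\<^sub>0) * \<gamma> * ?e" by linarith
    then have "c * norm (x t) \<le> c * ((d * norm y\<^sub>0) * \<gamma> * ?e)"
      using \<open>c > 0\<close> by (intro mult_left_mono) auto
    with xy(1)[OF t(2)] show ?thesis by (simp add: mult_ac)
  qed
  moreover have "c * d * \<gamma> > 0" using \<open>c > 0\<close> \<open>d > 0\<close> \<open>\<gamma> > 0\<close> by simp
  ultimately show ?thesis
    unfolding uniformly_exponentially_stable_def using \<open>\<alpha> > 0\<close> pr by blast
qed

theorem theorem2p12:
  fixes T :: "real set" and A L :: "real \<Rightarrow> real^'n^'n"
  assumes "time_scale T"
    and "regressive T A"
    and "lyapunov_transformation T L"
  shows "uniformly_exponentially_stable T A \<longleftrightarrow>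
    uniformly_exponentially_stable T
      (\<lambda>t. matrix_inv (L (forward_jump T t)) ** A t ** L t
           - matrix_inv (L (forward_jump T t)) ** delta_deriv T L t)"
    (is "_ \<longleftrightarrow> uniformly_exponentially_stable T ?B")
proof -
  obtain \<eta> \<rho> where "\<eta> > 0" "\<rho> > 0"
    and L: "\<And>t. t \<in> T \<Longrightarrow> onorm ((*v) (L t)) \<le> \<rho>" "\<And>t. t \<in> T \<Longrightarrow> det (L t) \<ge> \<eta>"
    using assms(3) unfolding lyapunov_transformation_def by blast
  have inv: "invertible (L t)" if "t \<in> T" for t
    using assms(3) that by (simp add: lyapunov_transformation_def)
  have kappa: "t \<in> T" if "t \<in> kappa T" for t using that by (simp add: kappa_def)
  have deriv: "has_delta_derivative T L (delta_deriv T L t) t" if "t \<in> kappa T" for t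
    using assms(3) that has_delta_derivative_delta_deriv
    unfolding lyapunov_transformation_def C1_rd_def by blast
  obtain m where "m > 0" and lower: "\<And>t u. t \<in> T \<Longrightarrow> m * norm u \<le> norm (L t *v u)"
    using det_ge_imp_lower_bound[OF \<open>\<eta> > 0\<close>, of \<rho>] L by metis
  have upper: "norm (L t *v u) \<le> \<rho> * norm u" if "t \<in> T" for t u
    using onorm[OF matrix_vector_mul_bounded_linear, of "L t" u] L(1)[OF that]
    by (meson mult_right_mono norm_ge_zero order_trans)
  have lower': "norm u \<le> inverse m * norm (L t *v u)" if "t \<in> T" for t u
    using lower[OF that, of u] \<open>m > 0\<close> by (simp add: field_simps)
  \<comment> \<open>The form of the derivative in the rule for \<open>matrix_inv\<close>, with
    \<open>L t *v u\<close> in the role of x(t).\<close>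
  have B: "?B t *v u = matrix_inv (L (forward_jump T t)) *v (A t *v (L t *v u) - delta_deriv T L t *v u)"
    for t u
    by (simp add: matrix_vector_mult_diff_rdistrib matrix_vector_mult_diff_distrib
        matrix_vector_mul_assoc matrix_mul_assoc)
  show ?thesis
  proof
    assume "uniformly_exponentially_stable T A"
    then show "uniformly_exponentially_stable T ?B"
    proof (rule uniformly_exponentially_stable_transfer[where c = "inverse m" and d = \<rho>])
      fix t\<^sub>0 z\<^sub>0 z assume "t\<^sub>0 \<in> T" and z: "solves_delta_ivp T (\<lambda>s u. ?B s *v u) t\<^sub>0 z\<^sub>0 z"
      have "has_delta_derivative T (\<lambda>s. L s *v z s) (A t *v (L t *v z t)) t"
        if t: "t \<in> kappa T" for t
      proof -
        have "has_delta_derivative T z (?B t *v z t) t"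
          using z t by (simp add: solves_delta_ivp_def)
        from has_delta_derivative_matrix_vector_mult[OF deriv[OF t] this kappa[OF t]]
        show ?thesis
          \<comment> \<open>L(\<sigma>(t)) cancels its inverse in \<open>?B\<close>, and then the
            two terms with the derivative of \<open>L\<close> cancel.\<close>
          using matrix_inv_mult_vector(2)[OF inv[OF forward_jump_mem[OF assms(1) kappa[OF t]]]]
          by (simp add: B)
      qed
      then have "solves_delta_ivp T (\<lambda>s u. A s *v u) t\<^sub>0 (L t\<^sub>0 *v z t\<^sub>0) (\<lambda>s. L s *v z s)"
        by (simp add: solves_delta_ivp_def)
      then show "\<exists>x. solves_delta_ivp T (\<lambda>s u. A s *v u) t\<^sub>0 (x t\<^sub>0) x \<and>
          (\<forall>t\<in>T. norm (z t) \<le> inverse m * norm (x t) \<and> norm (x t) \<le> \<rho> * norm (z t))"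
        using upper lower' by (intro exI[of _ "\<lambda>s. L s *v z s"]) auto
    qed (use \<open>m > 0\<close> \<open>\<rho> > 0\<close> in auto)
  next
    assume "uniformly_exponentially_stable T ?B"
    then show "uniformly_exponentially_stable T A"
    proof (rule uniformly_exponentially_stable_transfer[where c = \<rho> and d = "inverse m"])
      fix t\<^sub>0 x\<^sub>0 x assume "t\<^sub>0 \<in> T" and x: "solves_delta_ivp T (\<lambda>s u. A s *v u) t\<^sub>0 x\<^sub>0 x"
      define z where "z s = matrix_inv (L s) *v x s" for s
      have Lz: "L s *v z s = x s" if "s \<in> T" for s
        by (simp add: z_def matrix_inv_mult_vector inv that)
      have "has_delta_derivative T z (?B t *v z t) t" if t: "t \<in> kappa T" for t
      proof -
        have "has_delta_derivative T x (A t *v x t) t"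
          using x t by (simp add: solves_delta_ivp_def)
        from has_delta_derivative_matrix_inv_mult[OF deriv[OF t] this assms(1) kappa[OF t] inv
            \<open>m > 0\<close> lower]
        show ?thesis unfolding B Lz[OF kappa[OF t]] by (simp add: z_def[abs_def])
      qed
      then have "solves_delta_ivp T (\<lambda>s u. ?B s *v u) t\<^sub>0 (z t\<^sub>0) z"
        by (simp add: solves_delta_ivp_def)
      moreover have "norm (x t) \<le> \<rho> * norm (z t) \<and> norm (z t) \<le> inverse m * norm (x t)"
        if "t \<in> T" for t
        using upper[OF that, of "z t"] lower'[OF that, of "z t"] Lz[OF that] by simp
      ultimately show "\<exists>z. solves_delta_ivp T (\<lambda>s u. ?B s *v u) t\<^sub>0 (z t\<^sub>0) z \<and>
          (\<forall>t\<in>T. norm (x t) \<le> \<rho> * norm (z t) \<and> norm (z t) \<le> inverse m * norm (x t))"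
        by blast
    qed (use \<open>m > 0\<close> \<open>\<rho> > 0\<close> in auto)
  qed
qed

end
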